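(* Let $\alpha,\beta\in\,]0,1[$ be such that $\alpha+\beta<1$. Let $$\rho^\star=\sqrt{\frac{1}{C(M)}\,\frac1n\,\ln\big[1+d\,\eta(\alpha,\beta)^2\big]},$$ where $C(M)=1+M^2e^{M^2}/2$ and $\eta(\alpha,\beta)=2(1-\alpha-\beta)$. Then, if $\rho<\rho^\star$, $$\inf_{\Psi_\alpha}\ \sup_{f_{(\varepsilon,\mu)}\in\mathcal F_\infty[M],\ \varepsilon\|\mu\|_\infty\ge\rho}\ \mathbb{P}_{f_{(\varepsilon,\mu)}}(\Psi_\alpha=0)>\beta,$$ where the infimum is taken over all level-$\alpha$ tests. This implies that $$\underline{\rho}(\mathcal F_\infty[M],\alpha,\beta)\ge\rho^\star.$$
   Context: Let $M>0$ be given. Let $\phi_d$ be the density of the standard Gaussian distribution $\mathcal N_d(0_d,I_d)$ on $\mathbb{R}^d$. For $\varepsilon\in\,]0,1[$ and $\mu\in\mathbb{R}^d$ put $f_{(\varepsilon,\mu)}(x)=(1-\varepsilon)\phi_d(x)+\varepsilon\phi_d(x-\mu)$. Let $\|\mu\|_\infty=\max_{1\le j\le d}|\mu_j|$ and $\mathcal F_\infty[M]=\{f_{(\varepsilon,\mu)}:\varepsilon\in\,]0,1[,\ \|\mu\|_\infty\le M\}$. One observes an i.i.d. sample $\underline X=(X_1,\dots,X_n)$ of $\mathbb{R}^d$-valued random vectors. For a density $g$ on $\mathbb{R}^d$, $\mathbb{P}_g$ is the probability when the common density of the $X_i$ is $g$; $\mathbb{P}_0:=\mathbb{P}_{\phi_d}$.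 A test $\Psi$ is a measurable function of $\underline X$ with values in $\{0,1\}$; it has level $\alpha$ (written $\Psi_\alpha$) if $\mathbb{P}_0(\Psi=1)\le\alpha$. The uniform separation of a level-$\alpha$ test $\Psi_\alpha$ is $$\rho(\Psi_\alpha,\mathcal F_\infty[M],\beta)=\inf\Big\{\rho>0:\ \sup_{f_{(\varepsilon,\mu)}\in\mathcal F_\infty[M],\ \varepsilon\|\mu\|_\infty\ge\rho}\mathbb{P}_{f_{(\varepsilon,\mu)}}(\Psi_\alpha=0)\le\beta\Big\},$$ and the $(\alpha,\beta)$-minimax separation rate is $\underline\rho(\mathcal F_\infty[M],\alpha,\beta)=\inf_{\Psi_\alpha}\rho(\Psi_\alpha,\mathcal F_\infty[M],\beta)$, the infimum being over all level-$\alpha$ tests.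
   Formalization: If ρ* > M (e.g. n = 1, d large) the claims fail: no alternatives exist for M ≤ ρ < ρ*, and the minimax rate is at most M. So the first claim is stated for ρ < ρ* with a nonempty set of alternatives (i.e. ρ < M), the second under ρ* ≤ M. *)

theory Defs
  imports "HOL-Probability.Probability"
begin

definition std_gauss_density :: "real ^ 'd::finite \<Rightarrow> real" where
  "std_gauss_density x = (\<Prod>j\<in>UNIV. std_normal_density (x $ j))"

definition mixture_density :: "real \<Rightarrow> real ^ 'd::finite \<Rightarrow> real ^ 'd \<Rightarrow> real" where
  "mixture_density \<epsilon> \<mu> x = (1 - \<epsilon>) * std_gauss_density x + \<epsilon> * std_gauss_density (x - \<mu>)"

(* Classes of mixtures are represented by their sets of parameters (eps, mu), since the
   separation eps * ||mu||_inf is a function of the parameters. On real ^ 'd, the library's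
   infnorm is the maximum of the absolute values of the coordinates. *)
definition F_infty :: "real \<Rightarrow> (real \<times> (real ^ 'd::finite)) set" where
  "F_infty M = {(\<epsilon>, \<mu>). 0 < \<epsilon> \<and> \<epsilon> < 1 \<and> infnorm \<mu> \<le> M}"

definition separated :: "(real \<times> (real ^ 'd::finite)) set \<Rightarrow> real \<Rightarrow> (real \<times> (real ^ 'd)) set" where
  "separated F \<rho> = {(\<epsilon>, \<mu>). (\<epsilon>, \<mu>) \<in> F \<and> \<epsilon> * infnorm \<mu> \<ge> \<rho>}"

definition sample_law :: "nat \<Rightarrow> (real ^ 'd::finite \<Rightarrow> real) \<Rightarrow> (nat \<Rightarrow> real ^ 'd) measure" where
  "sample_law n g = PiM {..<n} (\<lambda>_. density lborel (\<lambda>x. ennreal (g x)))"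

definition prob_test_eq ::
    "nat \<Rightarrow> (real ^ 'd::finite \<Rightarrow> real) \<Rightarrow> ((nat \<Rightarrow> real ^ 'd) \<Rightarrow> nat) \<Rightarrow> nat \<Rightarrow> real" where
  "prob_test_eq n g \<Psi> v = measure (sample_law n g) {x \<in> space (sample_law n g). \<Psi> x = v}"

definition is_test :: "nat \<Rightarrow> ((nat \<Rightarrow> real ^ 'd::finite) \<Rightarrow> nat) \<Rightarrow> bool" where
  "is_test n \<Psi> \<longleftrightarrow> \<Psi> \<in> PiM {..<n} (\<lambda>_. borel) \<rightarrow>\<^sub>M count_space {0, 1}"

definition level_tests :: "nat \<Rightarrow> real \<Rightarrow> ((nat \<Rightarrow> real ^ 'd::finite) \<Rightarrow> nat) set" where
  "level_tests n \<alpha> = {\<Psi>. is_test n \<Psi> \<and> prob_test_eq n std_gauss_density \<Psi> 1 \<le> \<alpha>}"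

(* Suprema and infima are taken in the extended reals, so the supremum over an empty set of
   alternatives is minus infinity: for F_infty M this is the case exactly when rho >= M. *)
definition max_type2_error ::
    "nat \<Rightarrow> ((nat \<Rightarrow> real ^ 'd::finite) \<Rightarrow> nat) \<Rightarrow> (real \<times> (real ^ 'd)) set \<Rightarrow> real \<Rightarrow> ereal" where
  "max_type2_error n \<Psi> F \<rho> =
     (SUP (\<epsilon>, \<mu>) \<in> separated F \<rho>. ereal (prob_test_eq n (mixture_density \<epsilon> \<mu>) \<Psi> 0))"

definition uniform_separation ::
    "nat \<Rightarrow> ((nat \<Rightarrow> real ^ 'd::finite) \<Rightarrow> nat) \<Rightarrow> (real \<times> (real ^ 'd)) set \<Rightarrow> real \<Rightarrow> ereal" where
  "uniform_separation n \<Psi> F \<beta> =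
     Inf {ereal \<rho> | \<rho>. 0 < \<rho> \<and> max_type2_error n \<Psi> F \<rho> \<le> ereal \<beta>}"

definition minimax_separation ::
    "nat \<Rightarrow> (real \<times> (real ^ 'd::finite)) set \<Rightarrow> real \<Rightarrow> real \<Rightarrow> ereal" where
  "minimax_separation n F \<alpha> \<beta> = (INF \<Psi> \<in> level_tests n \<alpha>. uniform_separation n \<Psi> F \<beta>)"

definition C_const :: "real \<Rightarrow> real" where
  "C_const M = 1 + M\<^sup>2 * exp (M\<^sup>2) / 2"

definition eta :: "real \<Rightarrow> real \<Rightarrow> real" where
  "eta \<alpha> \<beta> = 2 * (1 - \<alpha> - \<beta>)"

definition rho_star :: "nat \<Rightarrow> nat \<Rightarrow> real \<Rightarrow> real \<Rightarrow> real \<Rightarrow> real" where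
  "rho_star d n M \<alpha> \<beta> =
     sqrt (1 / C_const M * (1 / real n) * ln (1 + real d * (eta \<alpha> \<beta>)\<^sup>2))"

end

theory Submission
  imports Defs
begin

text \<open>
  A test that separates the null hypothesis from all alternatives at distance \<open>\<rho>\<close> also separates it
  from every average of such alternatives. The average used here is uniform over the \<open>d\<close> mixtures
  with shift \<open>\<mu> = M e\<^sub>j\<close> and weight \<open>\<epsilon> = \<rho> / M\<close>, where \<open>0 < \<rho> < M\<close>. Under the null hypothesis the
  likelihood ratios of two such samples are uncorrelated when the coordinates differ, because the
  shifts are then orthogonal; only the \<open>d\<close> diagonal terms among \<open>d\<^sup>2\<close> contribute, and the chi-square
  divergence of the averaged law from the null law is
  \<open>((1 + \<epsilon>\<^sup>2 (exp (M\<^sup>2) - 1)) ^ n - 1) / d\<close>. The gain of a factor \<open>d\<close> is where the logarithm of the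
  dimension in \<open>\<rho>\<^sup>\<star>\<close> comes from.

  By Taylor's formula \<open>exp (M\<^sup>2) - 1 \<le> M\<^sup>2 C(M)\<close>, so the divergence is below \<open>\<eta>\<^sup>2\<close> as soon as
  \<open>n \<rho>\<^sup>2 C(M) < ln (1 + d \<eta>\<^sup>2)\<close>, which is the condition \<open>\<rho> < \<rho>\<^sup>\<star>\<close>
  (\<open>chi_square_less_eta\<close>). A chi-square divergence below \<open>\<eta>\<^sup>2\<close> changes the probability of any event
  by less than \<open>\<eta> / 2 = 1 - \<alpha> - \<beta>\<close> (\<open>centred_integral_event_ge\<close>, \<open>average_prob_ge\<close>). Acceptance
  has probability at least \<open>1 - \<alpha>\<close> under the null law, hence probability more than \<open>\<beta>\<close>
  under the average and under at least one alternative. The gap does not depend on the test, so the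
  inequality stays strict in the infimum over tests. If moreover \<open>\<rho>\<^sup>\<star> \<le> M\<close>, every separation below \<open>\<rho>\<^sup>\<star>\<close> is also
  below \<open>M\<close>, so that no test of level \<open>\<alpha>\<close> achieves it; this is the bound on the minimax rate.
\<close>

section \<open>Testing against a mixture of product laws\<close>

text \<open>The likelihood ratio of an i.i.d. sample is the product of the individual likelihood ratios;
  it suffices to compare both measures on boxes.\<close>

lemma density_PiM_prod:
  fixes f :: "'a \<Rightarrow> real"
  assumes N: "prob_space N" and fN: "prob_space (density N f)"
    and [measurable]: "f \<in> borel_measurable N" and nonneg: "\<And>x. 0 \<le> f x"
    and I: "finite I"
  shows "PiM I (\<lambda>_. density N f) = density (PiM I (\<lambda>_. N)) (\<lambda>x. ennreal (\<Prod>i\<in>I. f (x i)))"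
proof -
  interpret N: prob_space N by fact
  interpret fN: prob_space "density N f" by fact
  interpret PN: product_sigma_finite "\<lambda>_. N" ..
  interpret PfN: product_sigma_finite "\<lambda>_. density N f" ..
  show ?thesis
  proof (rule PfN.PiM_eqI[symmetric])
    show "finite I" by fact
    show "sets (density (PiM I (\<lambda>_. N)) (\<lambda>x. ennreal (\<Prod>i\<in>I. f (x i))))
        = sets (PiM I (\<lambda>_. density N f))"
      by (simp cong: sets_PiM_cong)
  next
    fix A assume "\<And>i. i \<in> I \<Longrightarrow> A i \<in> sets (density N f)"
    then have A: "\<And>i. i \<in> I \<Longrightarrow> A i \<in> sets N" by simp
    then have PA: "Pi\<^sub>E I A \<in> sets (PiM I (\<lambda>_. N))"
      using I by (intro sets_PiM_I_finite) auto
    have "emeasure (density (PiM I (\<lambda>_. N)) (\<lambda>x. ennreal (\<Prod>i\<in>I. f (x i)))) (Pi\<^sub>E I A)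
        = (\<integral>\<^sup>+x. ennreal (\<Prod>i\<in>I. f (x i)) * indicator (Pi\<^sub>E I A) x \<partial>PiM I (\<lambda>_. N))"
      using PA by (intro emeasure_density) auto
    also have "\<dots> = (\<integral>\<^sup>+x. (\<Prod>i\<in>I. ennreal (f (x i)) * indicator (A i) (x i)) \<partial>PiM I (\<lambda>_. N))"
    proof (rule nn_integral_cong)
      fix x assume "x \<in> space (PiM I (\<lambda>_. N))"
      then have ext: "x \<in> extensional I" by (simp add: space_PiM PiE_def)
      have "indicator (Pi\<^sub>E I A) x = (\<Prod>i\<in>I. indicator (A i) (x i) :: ennreal)"
      proof (cases "x \<in> Pi\<^sub>E I A")
        case True
        then show ?thesis by (auto intro!: prod.neutral[symmetric] simp: PiE_def Pi_def)
      next
        case False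
        then obtain i where "i \<in> I" "x i \<notin> A i" using ext by (auto simp: PiE_def Pi_def)
        then have "(\<Prod>i\<in>I. indicator (A i) (x i) :: ennreal) = 0"
          using I by (intro prod_zero) (auto intro!: bexI[of _ i])
        then show ?thesis using False by simp
      qed
      then show "ennreal (\<Prod>i\<in>I. f (x i)) * indicator (Pi\<^sub>E I A) x
          = (\<Prod>i\<in>I. ennreal (f (x i)) * indicator (A i) (x i))"
        by (simp add: prod.distrib prod_ennreal nonneg)
    qed
    also have "\<dots> = (\<Prod>i\<in>I. \<integral>\<^sup>+y. ennreal (f y) * indicator (A i) y \<partial>N)"
      using I A by (intro PN.product_nn_integral_prod) auto
    also have "\<dots> = (\<Prod>i\<in>I. emeasure (density N f) (A i))"
      using A by (intro prod.cong) (auto simp: emeasure_density)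
    finally show "emeasure (density (PiM I (\<lambda>_. N)) (\<lambda>x. ennreal (\<Prod>i\<in>I. f (x i)))) (Pi\<^sub>E I A)
        = (\<Prod>i\<in>I. emeasure (density N f) (A i))" .
  qed
qed

text \<open>
  With \<open>D\<close> the centred likelihood ratio \<open>dQ / dP - 1\<close>, the integral of \<open>D\<close> over \<open>A\<close> is
  \<open>Q(A) - P(A)\<close>. Centring allows the indicator of \<open>A\<close> to be replaced by the indicator minus
  \<open>1 / 2\<close>, which has constant square \<open>1 / 4\<close>; this halves the constant that Cauchy-Schwarz would
  give for the indicator alone. The square root in Cauchy-Schwarz is avoided by the free parameter
  \<open>s\<close>, optimal when \<open>s\<^sup>2\<close> is the second moment of \<open>D\<close>.
\<close>

lemma (in prob_space) centred_integral_event_ge: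
  fixes D :: "'a \<Rightarrow> real"
  assumes D: "integrable M D" and D2: "integrable M (\<lambda>x. (D x)\<^sup>2)"
    and centred: "(\<integral>x. D x \<partial>M) = 0" and A: "A \<in> events" and s: "0 < s"
  shows "(\<integral>x. D x * indicator A x \<partial>M) \<ge> - (((\<integral>x. (D x)\<^sup>2 \<partial>M) + s\<^sup>2) / (4 * s))"
proof -
  have DA: "integrable M (\<lambda>x. D x * indicator A x)"
    using integrable_mult_indicator[OF A D] by (simp add: mult.commute)
  have "0 \<le> (\<integral>x. (D x + 2 * s * (indicator A x - 1 / 2))\<^sup>2 \<partial>M)"
    by simp
  also have "\<dots> = (\<integral>x. (D x)\<^sup>2 + 4 * s * (D x * indicator A x) - 2 * s * D x + s\<^sup>2 \<partial>M)"
    by (intro Bochner_Integration.integral_cong refl)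
      (auto simp: indicator_def power2_eq_square algebra_simps)
  also have "\<dots> = (\<integral>x. (D x)\<^sup>2 \<partial>M) + 4 * s * (\<integral>x. D x * indicator A x \<partial>M) + s\<^sup>2"
    using D D2 DA by (simp add: centred prob_space)
  finally show ?thesis using s by (simp add: field_simps)
qed

text \<open>
  Second-moment bound for the uniform average over \<open>j\<close> of the product laws with marginal likelihood
  ratio \<open>l j\<close>. The second moment of the averaged likelihood ratio is the mean of the \<open>d\<^sup>2\<close>
  cross-moments, each an \<open>n\<close>-th power by independence; as only the diagonal ones can differ from 1, the
  chi-square divergence is \<open>((1 + q) ^ n - 1) / d\<close>.
\<close>

lemma average_prob_ge:
  fixes l :: "'j::finite \<Rightarrow> 'a \<Rightarrow> real"
  assumes N: "prob_space N"
    and nonneg: "\<And>j x. 0 \<le> l j x"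
    and int: "\<And>j. integrable N (l j)" and mean: "\<And>j. (\<integral>x. l j x \<partial>N) = 1"
    and int2: "\<And>j k. integrable N (\<lambda>x. l j x * l k x)"
    and corr: "\<And>j k. (\<integral>x. l j x * l k x \<partial>N) = (if j = k then 1 + q else 1)"
    and A: "A \<in> sets (PiM {..<n} (\<lambda>_. N))" and s: "0 < s"
  shows "(\<Sum>j\<in>UNIV. measure (PiM {..<n} (\<lambda>_. density N (l j))) A) / CARD('j)
    \<ge> measure (PiM {..<n} (\<lambda>_. N)) A - (((1 + q) ^ n - 1) / CARD('j) + s\<^sup>2) / (4 * s)"
proof -
  interpret N: prob_space N by fact
  interpret PN: product_sigma_finite "\<lambda>_. N" ..
  let ?P = "PiM {..<n} (\<lambda>_. N)"
  interpret P: prob_space ?P using N by (intro prob_space_PiM)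
  have [measurable]: "l j \<in> borel_measurable N" for j using int by auto
  define L where "L j x = (\<Prod>i<n. l j (x i))" for j and x :: "nat \<Rightarrow> 'a"
  let ?d = "real CARD('j)"
  have L_int: "integrable ?P (L j)" for j
    unfolding L_def using int by (intro PN.product_integrable_prod) auto
  have L_mean: "(\<integral>x. L j x \<partial>?P) = 1" for j
    unfolding L_def using int mean by (subst PN.product_integral_prod) auto
  have LL: "L j x * L k x = (\<Prod>i<n. l j (x i) * l k (x i))" for j k x
    by (simp add: L_def prod.distrib)
  have LL_int: "integrable ?P (\<lambda>x. L j x * L k x)" for j k
    unfolding LL using int2 by (intro PN.product_integrable_prod) auto
  have LL_mean: "(\<integral>x. L j x * L k x \<partial>?P) = (if j = k then (1 + q) ^ n else 1)" for j k
    unfolding LL by (subst PN.product_integral_prod) (auto simp: int2 corr)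
  have prob_fN: "prob_space (density N (l j))" for j
    using int mean nonneg
    by (intro prob_spaceI) (simp add: emeasure_density nn_integral_eq_integral)
  have meas: "measure (PiM {..<n} (\<lambda>_. density N (l j))) A = (\<integral>x. L j x * indicator A x \<partial>?P)" for j
  proof -
    have "emeasure (PiM {..<n} (\<lambda>_. density N (l j))) A
        = (\<integral>\<^sup>+x. ennreal (L j x) * indicator A x \<partial>?P)"
      unfolding L_def
      using A by (subst density_PiM_prod) (auto simp: N prob_fN nonneg emeasure_density)
    also have "\<dots> = (\<integral>\<^sup>+x. ennreal (L j x * indicator A x) \<partial>?P)"
      by (intro nn_integral_cong) (auto simp: indicator_def)
    also have "\<dots> = ennreal (\<integral>x. L j x * indicator A x \<partial>?P)"
      using integrable_mult_indicator[OF A L_int]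
      by (intro nn_integral_eq_integral) (auto simp: L_def nonneg prod_nonneg mult.commute)
    finally show ?thesis
      by (simp add: measure_def L_def nonneg prod_nonneg)
  qed
  define D where "D x = (\<Sum>j\<in>UNIV. L j x) / ?d - 1" for x
  have D_int: "integrable ?P D" unfolding D_def using L_int by auto
  have D_mean: "(\<integral>x. D x \<partial>?P) = 0"
    unfolding D_def using L_int by (simp add: L_mean P.prob_space)
  have D2: "(D x)\<^sup>2 = (\<Sum>j\<in>UNIV. \<Sum>k\<in>UNIV. L j x * L k x) / ?d\<^sup>2 - 2 * D x - 1" for x
    by (simp add: D_def power2_eq_square field_simps sum_product)
  have D2_int: "integrable ?P (\<lambda>x. (D x)\<^sup>2)"
    unfolding D2 using LL_int D_int by auto
  have "(\<integral>x. (D x)\<^sup>2 \<partial>?P)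
      = (\<Sum>j\<in>(UNIV::'j set). \<Sum>k\<in>UNIV. if j = k then (1 + q) ^ n else 1 :: real) / ?d\<^sup>2 - 1"
    unfolding D2 using LL_int D_int by (simp add: D_mean LL_mean P.prob_space)
  also have "(\<Sum>j\<in>(UNIV::'j set). \<Sum>k\<in>UNIV. if j = k then (1 + q) ^ n else 1 :: real)
      = (\<Sum>j\<in>(UNIV::'j set). \<Sum>k\<in>UNIV. (if j = k then (1 + q) ^ n - 1 else 0) + 1)"
    by (intro sum.cong) auto
  also have "\<dots> = ?d * ((1 + q) ^ n - 1 + ?d)"
    by (simp add: sum.distrib)
  also have "\<dots> / ?d\<^sup>2 - 1 = ((1 + q) ^ n - 1) / ?d"
    by (simp add: power2_eq_square field_simps)
  finally have chi2: "(\<integral>x. (D x)\<^sup>2 \<partial>?P) = ((1 + q) ^ n - 1) / ?d" .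
  have LA_int: "integrable ?P (\<lambda>x. L j x * indicator A x)" for j
    using integrable_mult_indicator[OF A L_int] by (simp add: mult.commute)
  have A_int: "integrable ?P (indicator A :: _ \<Rightarrow> real)"
    using A by (simp add: integrable_indicator_iff P.emeasure_finite less_top[symmetric])
  have "(\<Sum>j\<in>UNIV. measure (PiM {..<n} (\<lambda>_. density N (l j))) A) / ?d
      = (\<integral>x. (\<Sum>j\<in>UNIV. L j x * indicator A x) / ?d \<partial>?P)"
    using LA_int unfolding meas
    by (subst integral_divide_zero, subst Bochner_Integration.integral_sum) simp_all
  also have "\<dots> = (\<integral>x. D x * indicator A x + indicator A x \<partial>?P)"
    by (intro Bochner_Integration.integral_cong refl)
      (simp add: D_def sum_distrib_right[symmetric] algebra_simps)
  also have "\<dots> = (\<integral>x. D x * indicator A x \<partial>?P) + measure ?P A"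
    using integrable_mult_indicator[OF A D_int] A_int A by (simp add: mult.commute)
  finally show ?thesis
    using P.centred_integral_event_ge[OF D_int D2_int D_mean A s] by (simp add: chi2)
qed

section \<open>Likelihood ratios of Gaussian shifts\<close>

text \<open>The density of \<open>N(a, I)\<close> with respect to \<open>N(0, I)\<close>.\<close>

definition shift_ratio :: "real ^ 'd::finite \<Rightarrow> real ^ 'd \<Rightarrow> real" where
  "shift_ratio a x = exp (a \<bullet> x - (a \<bullet> a) / 2)"

abbreviation std_gauss :: "(real ^ 'd::finite) measure" where
  "std_gauss \<equiv> density lborel (\<lambda>x. ennreal (std_gauss_density x))"

lemma std_gauss_density_nonneg [simp]: "0 \<le> std_gauss_density x"
  by (simp add: std_gauss_density_def prod_nonneg)

lemma borel_measurable_std_gauss_density [measurable]: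
  "std_gauss_density \<in> borel_measurable borel"
  unfolding std_gauss_density_def[abs_def] by measurable

lemma borel_measurable_shift_ratio [measurable]: "shift_ratio a \<in> borel_measurable borel"
  unfolding shift_ratio_def[abs_def] by measurable

lemma std_gauss_density_shift:
  "std_gauss_density (x - a) = std_gauss_density x * shift_ratio a x"
proof -
  have "shift_ratio a x = (\<Prod>j\<in>UNIV. exp (a $ j * x $ j - a $ j * a $ j / 2))"
    by (simp add: shift_ratio_def inner_vec_def exp_sum[symmetric] sum_subtractf sum_divide_distrib)
  moreover have "std_normal_density (y - b) = std_normal_density y * exp (b * y - b * b / 2)"
    for y b :: real
  proof -
    have "- (y - b)\<^sup>2 / 2 = - y\<^sup>2 / 2 + (b * y - b * b / 2)"
      by (simp add: power2_eq_square field_simps)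
    then show ?thesis by (simp only: std_normal_density_def exp_add mult.assoc)
  qed
  ultimately show ?thesis
    unfolding std_gauss_density_def by (simp add: prod.distrib)
qed

text \<open>The product is again a shift ratio up to a constant, so integrating it needs no computation
  beyond the normalisation of the Gaussian density.\<close>

lemma shift_ratio_mult:
  "shift_ratio a x * shift_ratio b x = exp (a \<bullet> b) * shift_ratio (a + b) x"
  by (simp add: shift_ratio_def exp_add[symmetric] inner_add_left inner_add_right inner_commute
      field_simps)

lemma nn_integral_std_gauss_density_shift:
  fixes a :: "real ^ 'd::finite"
  shows "(\<integral>\<^sup>+x. ennreal (std_gauss_density (x - a)) \<partial>lborel) = 1"
proof -
  have bij: "bij_betw (\<lambda>j. axis j (1::real)) (UNIV :: 'd set) Basis"
    by (auto simp: bij_betw_def inj_on_def axis_eq_axis Basis_vec_def)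
  have "std_gauss_density (x - a) = (\<Prod>b\<in>Basis. normal_density (a \<bullet> b) 1 (x \<bullet> b))" for x
    unfolding std_gauss_density_def
    by (subst prod.reindex_bij_betw[OF bij, symmetric])
      (simp add: normal_density_def inner_axis)
  then have "(\<integral>\<^sup>+x. ennreal (std_gauss_density (x - a)) \<partial>lborel)
      = (\<integral>\<^sup>+x. (\<Prod>b\<in>Basis. ennreal (normal_density (a \<bullet> b) 1 (x \<bullet> b))) \<partial>lborel)"
    by (simp add: prod_ennreal)
  also have "\<dots> = (\<Prod>b\<in>Basis. \<integral>\<^sup>+y. ennreal (normal_density (a \<bullet> b) 1 y) \<partial>lborel)"
    by (rule nn_integral_lborel_prod) auto
  also have "\<dots> = 1"
    by (intro prod.neutral) (simp add: nn_integral_eq_integral integrable_normal_density)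
  finally show ?thesis .
qed

lemma prob_space_std_gauss: "prob_space std_gauss"
  using nn_integral_std_gauss_density_shift[of 0]
  by (intro prob_spaceI) (simp add: emeasure_density)

lemma has_bochner_integral_shift_ratio: "has_bochner_integral std_gauss (shift_ratio a) 1"
proof (rule has_bochner_integral_nn_integral)
  show "(\<integral>\<^sup>+x. ennreal (shift_ratio a x) \<partial>std_gauss) = ennreal 1"
    using nn_integral_std_gauss_density_shift[of a]
    by (simp add: nn_integral_density std_gauss_density_shift ennreal_mult shift_ratio_def)
qed (auto simp: shift_ratio_def)

definition mixture_ratio :: "real \<Rightarrow> real ^ 'd::finite \<Rightarrow> real ^ 'd \<Rightarrow> real" where
  "mixture_ratio \<epsilon> \<mu> x = (1 - \<epsilon>) + \<epsilon> * shift_ratio \<mu> x"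

lemma mixture_density_eq: "mixture_density \<epsilon> \<mu> x = std_gauss_density x * mixture_ratio \<epsilon> \<mu> x"
  by (simp add: mixture_density_def mixture_ratio_def std_gauss_density_shift algebra_simps)

lemma density_mixture_density:
  fixes \<mu> :: "real ^ 'd::finite"
  assumes "0 \<le> \<epsilon>" "\<epsilon> \<le> 1"
  shows "density lborel (\<lambda>x. ennreal (mixture_density \<epsilon> \<mu> x))
    = density std_gauss (\<lambda>x. ennreal (mixture_ratio \<epsilon> \<mu> x))"
proof -
  have [measurable]: "mixture_ratio \<epsilon> \<mu> \<in> borel_measurable borel"
    unfolding mixture_ratio_def[abs_def] by measurable
  have "0 \<le> mixture_ratio \<epsilon> \<mu> x" for x
    using assms by (simp add: mixture_ratio_def shift_ratio_def)
  then show ?thesis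
    by (subst density_density_eq) (auto simp: mixture_density_eq ennreal_mult)
qed

lemma has_bochner_integral_mixture_ratio:
  fixes \<mu> :: "real ^ 'd::finite"
  shows "has_bochner_integral std_gauss (mixture_ratio \<epsilon> \<mu>) 1"
proof -
  interpret prob_space "std_gauss :: (real ^ 'd) measure" by (rule prob_space_std_gauss)
  have "has_bochner_integral std_gauss (\<lambda>x. (1 - \<epsilon>) + \<epsilon> * shift_ratio \<mu> x)
      ((1 - \<epsilon>) + \<epsilon> * 1)"
    by (intro has_bochner_integral_add has_bochner_integral_mult_right
        has_bochner_integral_shift_ratio) (simp add: has_bochner_integral_iff prob_space[simplified])
  then show ?thesis by (simp add: mixture_ratio_def[abs_def])
qed

text \<open>The correlation is governed by the inner product of the shifts: the
  two ratios are uncorrelated when the shifts are orthogonal.\<close>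

lemma has_bochner_integral_mixture_ratio_mult:
  fixes \<mu> \<nu> :: "real ^ 'd::finite"
  shows "has_bochner_integral std_gauss (\<lambda>x. mixture_ratio \<epsilon> \<mu> x * mixture_ratio \<epsilon> \<nu> x)
    (1 + \<epsilon>\<^sup>2 * (exp (\<mu> \<bullet> \<nu>) - 1))"
proof -
  have "mixture_ratio \<epsilon> \<mu> x * mixture_ratio \<epsilon> \<nu> x
      = (1 - \<epsilon>) * mixture_ratio \<epsilon> \<mu> x + (1 - \<epsilon>) * \<epsilon> * shift_ratio \<nu> x
        + \<epsilon>\<^sup>2 * exp (\<mu> \<bullet> \<nu>) * shift_ratio (\<mu> + \<nu>) x" for x
    using shift_ratio_mult[of \<mu> x \<nu>]
    by (simp add: mixture_ratio_def power2_eq_square algebra_simps)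
  moreover have "has_bochner_integral std_gauss
      (\<lambda>x. (1 - \<epsilon>) * mixture_ratio \<epsilon> \<mu> x + (1 - \<epsilon>) * \<epsilon> * shift_ratio \<nu> x
        + \<epsilon>\<^sup>2 * exp (\<mu> \<bullet> \<nu>) * shift_ratio (\<mu> + \<nu>) x)
      ((1 - \<epsilon>) * 1 + (1 - \<epsilon>) * \<epsilon> * 1 + \<epsilon>\<^sup>2 * exp (\<mu> \<bullet> \<nu>) * 1)"
    by (intro has_bochner_integral_add has_bochner_integral_mult_right
        has_bochner_integral_shift_ratio has_bochner_integral_mixture_ratio)
  moreover have "(1 - \<epsilon>) * 1 + (1 - \<epsilon>) * \<epsilon> * 1 + \<epsilon>\<^sup>2 * exp (\<mu> \<bullet> \<nu>) * 1
      = 1 + \<epsilon>\<^sup>2 * (exp (\<mu> \<bullet> \<nu>) - 1)"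
    by (simp add: power2_eq_square algebra_simps)
  ultimately show ?thesis by (simp only:)
qed

section \<open>The separation below which testing fails\<close>

lemma C_const_pos: "0 < C_const M"
  by (simp add: C_const_def add_pos_nonneg)

text \<open>Second-order Taylor expansion of \<open>exp\<close> at 0 in the variable \<open>M\<^sup>2\<close>; this bound is what fixes the
  form of \<open>C(M)\<close>.\<close>

lemma exp_square_minus_1_le: "exp (M\<^sup>2) - 1 \<le> M\<^sup>2 * C_const M"
proof -
  obtain t where t: "\<bar>t\<bar> \<le> \<bar>M\<^sup>2\<bar>"
    and exp: "exp (M\<^sup>2) = (\<Sum>m<2. (M\<^sup>2) ^ m / fact m) + exp t / fact 2 * (M\<^sup>2)\<^sup>2"
    using Maclaurin_exp_le[of "M\<^sup>2" 2] by blast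
  have "exp t * (M\<^sup>2)\<^sup>2 \<le> exp (M\<^sup>2) * (M\<^sup>2)\<^sup>2"
    using t by (intro mult_right_mono) auto
  then show ?thesis
    using exp by (simp add: C_const_def numeral_2_eq_2 power2_eq_square algebra_simps)
qed

text \<open>The left-hand side is the chi-square divergence for weight \<open>\<rho> / M\<close> and shifts \<open>M e\<^sub>j\<close>. The
  proof bounds \<open>(1 + z) ^ n\<close> by \<open>exp (n z)\<close>.\<close>

lemma chi_square_less_eta:
  assumes M: "0 < M" and n: "n \<ge> 1" and d: "d \<ge> 1"
    and \<rho>: "0 \<le> \<rho>" "\<rho> < rho_star d n M \<alpha> \<beta>"
  shows "((1 + (\<rho> / M)\<^sup>2 * (exp (M\<^sup>2) - 1)) ^ n - 1) / d < (eta \<alpha> \<beta>)\<^sup>2"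
proof -
  let ?z = "(\<rho> / M)\<^sup>2 * (exp (M\<^sup>2) - 1)"
  let ?ln = "ln (1 + real d * (eta \<alpha> \<beta>)\<^sup>2)"
  have z0: "0 \<le> ?z" by simp
  have "sqrt (\<rho>\<^sup>2) < sqrt (1 / C_const M * (1 / real n) * ?ln)"
    using \<rho> unfolding rho_star_def by simp
  then have "\<rho>\<^sup>2 < 1 / C_const M * (1 / real n) * ?ln"
    by (simp only: real_sqrt_less_iff)
  then have "real n * (\<rho>\<^sup>2 * C_const M) < ?ln"
    using C_const_pos[of M] n by (simp add: field_simps)
  moreover have "?z \<le> \<rho>\<^sup>2 * C_const M"
    using mult_left_mono[OF exp_square_minus_1_le[of M], of "(\<rho> / M)\<^sup>2"] M
    by (simp add: power_divide)
  ultimately have less: "real n * ?z < ?ln"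
    using mult_left_mono[of ?z "\<rho>\<^sup>2 * C_const M" "real n"] by simp
  have "(1 + ?z) ^ n \<le> exp ?z ^ n"
    using z0 by (intro power_mono exp_ge_add_one_self) auto
  also have "\<dots> = exp (real n * ?z)" by (simp add: exp_of_nat_mult)
  also have "\<dots> < exp ?ln" using less by simp
  also have "\<dots> = 1 + real d * (eta \<alpha> \<beta>)\<^sup>2"
    by (intro exp_ln) (simp add: add_pos_nonneg)
  finally show ?thesis using d by (simp add: field_simps)
qed

lemma infnorm_axis:
  fixes j :: "'d::finite"
  shows "infnorm (axis j t :: real ^ 'd) = \<bar>t\<bar>"
proof (rule antisym)
  show "infnorm (axis j t :: real ^ 'd) \<le> \<bar>t\<bar>"
    using infnorm_le_norm[of "axis j t :: real ^ 'd"]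
    by (simp add: norm_eq_sqrt_inner inner_axis)
  show "\<bar>t\<bar> \<le> infnorm (axis j t :: real ^ 'd)"
    using component_le_infnorm_cart[of "axis j t :: real ^ 'd" j] by simp
qed

text \<open>The bound holds for the average of the type II errors over the \<open>d\<close> coordinate directions,
  hence for at least one of them.\<close>

lemma ex_axis_type2_error_ge:
  fixes \<Psi> :: "(nat \<Rightarrow> real ^ 'd::finite) \<Rightarrow> nat"
  assumes \<epsilon>: "0 < \<epsilon>" "\<epsilon> < 1" and s: "0 < s" and \<Psi>: "\<Psi> \<in> level_tests n \<alpha>"
  shows "\<exists>j. prob_test_eq n (mixture_density \<epsilon> (axis j \<tau> :: real ^ 'd)) \<Psi> 0
    \<ge> 1 - \<alpha> - (((1 + \<epsilon>\<^sup>2 * (exp (\<tau>\<^sup>2) - 1)) ^ n - 1) / CARD('d) + s\<^sup>2) / (4 * s)"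
    (is "\<exists>j. ?p j \<ge> ?b")
proof -
  let ?N = "std_gauss :: (real ^ 'd) measure"
  let ?P = "PiM {..<n} (\<lambda>_. ?N)"
  define A where "A = {x \<in> space ?P. \<Psi> x = 0}"
  interpret P: prob_space ?P by (intro prob_space_PiM prob_space_std_gauss)
  have meas: "measurable ?P (count_space {0, 1 :: nat})
      = measurable (PiM {..<n} (\<lambda>_. borel)) (count_space {0, 1})"
    by (intro measurable_cong_sets sets_PiM_cong) auto
  have "is_test n \<Psi>" using \<Psi> by (simp add: level_tests_def)
  then have \<Psi>_meas: "\<Psi> \<in> ?P \<rightarrow>\<^sub>M count_space {0, 1}"
    unfolding is_test_def meas .
  have \<Psi>01: "\<Psi> x \<in> {0, 1}" if "x \<in> space ?P" for x
    using measurable_space[OF \<Psi>_meas that] by simp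
  have A: "A \<in> sets ?P"
  proof -
    have "A = \<Psi> -` {0} \<inter> space ?P" by (auto simp: A_def)
    also have "\<dots> \<in> sets ?P" using \<Psi>_meas by (rule measurable_sets) simp
    finally show ?thesis .
  qed
  have "space ?P - A = {x \<in> space ?P. \<Psi> x = 1}"
    using \<Psi>01 unfolding A_def by force
  then have "P.prob (space ?P - A) \<le> \<alpha>"
    using \<Psi> by (simp add: level_tests_def prob_test_eq_def sample_law_def)
  then have level: "1 - \<alpha> \<le> P.prob A"
    using P.prob_compl[OF A] by simp
  have pj: "?p j = measure (PiM {..<n} (\<lambda>_. density ?N (mixture_ratio \<epsilon> (axis j \<tau>)))) A" for j
    using \<epsilon> by (simp add: prob_test_eq_def sample_law_def density_mixture_density A_def space_PiM)
  have "(\<Sum>j\<in>UNIV. ?p j) / CARD('d)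
      \<ge> P.prob A - (((1 + \<epsilon>\<^sup>2 * (exp (\<tau>\<^sup>2) - 1)) ^ n - 1) / CARD('d) + s\<^sup>2) / (4 * s)"
    unfolding pj
  proof (rule average_prob_ge[OF prob_space_std_gauss _ _ _ _ _ A s])
    fix j k :: 'd
    have inner: "(axis j \<tau> :: real ^ 'd) \<bullet> axis k \<tau> = (if j = k then \<tau>\<^sup>2 else 0)"
      by (simp add: inner_axis_axis power2_eq_square)
    note ratio = has_bochner_integral_mixture_ratio
    note ratio2 = has_bochner_integral_mixture_ratio_mult
    show "integrable ?N (mixture_ratio \<epsilon> (axis j \<tau>))"
      "(\<integral>x. mixture_ratio \<epsilon> (axis j \<tau>) x \<partial>?N) = 1"
      using ratio by (auto simp: has_bochner_integral_iff)
    show "integrable ?N (\<lambda>x. mixture_ratio \<epsilon> (axis j \<tau>) x * mixture_ratio \<epsilon> (axis k \<tau>) x)"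
      "(\<integral>x. mixture_ratio \<epsilon> (axis j \<tau>) x * mixture_ratio \<epsilon> (axis k \<tau>) x \<partial>?N)
        = (if j = k then 1 + \<epsilon>\<^sup>2 * (exp (\<tau>\<^sup>2) - 1) else 1)"
      using ratio2[of \<epsilon> "axis j \<tau>" "axis k \<tau>"] by (auto simp: has_bochner_integral_iff inner)
  qed (use \<epsilon> in \<open>simp add: mixture_ratio_def shift_ratio_def\<close>)
  with level have avg: "?b \<le> (\<Sum>j\<in>UNIV. ?p j) / CARD('d)" by linarith
  show ?thesis
  proof (rule ccontr)
    assume "\<not> ?thesis"
    then have "(\<Sum>j\<in>UNIV. ?p j) < (\<Sum>j\<in>(UNIV :: 'd set). ?b)"
      by (intro sum_strict_mono) (auto simp: not_le)
    with avg show False by (simp add: field_simps)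
  qed
qed

text \<open>
  The separation \<open>r\<close> may be nonpositive, whereas the weight \<open>\<rho> / M\<close> of the witnessing alternatives has
  to be positive; since the separated classes shrink as the separation grows, alternatives at any
  larger distance \<open>\<rho>\<close> do. The shift is taken of the maximal size \<open>M\<close>, so that \<open>\<rho> / M < 1\<close>.
\<close>

lemma max_type2_error_ge:
  fixes \<Psi> :: "(nat \<Rightarrow> real ^ 'd::finite) \<Rightarrow> nat"
  assumes \<rho>: "0 < \<rho>" "\<rho> < M" and r: "r \<le> \<rho>" and s: "0 < s" and \<Psi>: "\<Psi> \<in> level_tests n \<alpha>"
  shows "max_type2_error n \<Psi> (F_infty M) r
    \<ge> ereal (1 - \<alpha> - (((1 + (\<rho> / M)\<^sup>2 * (exp (M\<^sup>2) - 1)) ^ n - 1) / CARD('d) + s\<^sup>2) / (4 * s))"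
proof -
  have \<epsilon>: "0 < \<rho> / M" "\<rho> / M < 1" using \<rho> by auto
  obtain j :: 'd where j: "prob_test_eq n (mixture_density (\<rho> / M) (axis j M)) \<Psi> 0
      \<ge> 1 - \<alpha> - (((1 + (\<rho> / M)\<^sup>2 * (exp (M\<^sup>2) - 1)) ^ n - 1) / CARD('d) + s\<^sup>2) / (4 * s)"
    using ex_axis_type2_error_ge[OF \<epsilon> s \<Psi>] by blast
  have "(\<rho> / M, axis j M :: real ^ 'd) \<in> separated (F_infty M) r"
    using \<rho> r by (simp add: separated_def F_infty_def infnorm_axis)
  then have "ereal (prob_test_eq n (mixture_density (\<rho> / M) (axis j M)) \<Psi> 0)
      \<le> max_type2_error n \<Psi> (F_infty M) r"
    unfolding max_type2_error_def by (rule SUP_upper2) simp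
  then show ?thesis using j by (meson ereal_less_eq(3) order_trans)
qed

theorem theorem3:
  fixes M \<alpha> \<beta> :: real and n :: nat
    and F :: "(real \<times> (real ^ 'd::finite)) set"
  assumes "M > 0"
    and "n \<ge> 1"
    and "0 < \<alpha>" "\<alpha> < 1" "0 < \<beta>" "\<beta> < 1"
    and "\<alpha> + \<beta> < 1"
  defines "F \<equiv> F_infty M"
    and "\<rho>\<^sub>s \<equiv> rho_star CARD('d) n M \<alpha> \<beta>"
  shows "(\<forall>\<rho>. \<rho> < \<rho>\<^sub>s \<and> separated F \<rho> \<noteq> {}
            \<longrightarrow> (INF \<Psi> \<in> level_tests n \<alpha>. max_type2_error n \<Psi> F \<rho>) > ereal \<beta>)
       \<and> (\<rho>\<^sub>s \<le> M \<longrightarrow> minimax_separation n F \<alpha> \<beta> \<ge> ereal \<rho>\<^sub>s)"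
proof -
  have \<eta>: "0 < eta \<alpha> \<beta>" using assms by (simp add: eta_def)
  have \<rho>s: "0 < \<rho>\<^sub>s"
    using assms(2) \<eta> C_const_pos[of M] by (simp add: \<rho>\<^sub>s_def rho_star_def add_pos_pos)
  have lower: "(INF \<Psi> \<in> level_tests n \<alpha>. max_type2_error n \<Psi> F \<rho>) > ereal \<beta>"
    if "\<rho> < \<rho>\<^sub>s" "\<rho> < M" for \<rho>
  proof -
    \<comment> \<open>For small or nonpositive \<open>\<rho>\<close> the alternatives are placed halfway to the
      smaller of \<open>\<rho>\<^sup>\<star>\<close> and \<open>M\<close>.\<close>
    define r where "r = max \<rho> (min \<rho>\<^sub>s M / 2)"
    have r: "0 < r" "r < \<rho>\<^sub>s" "r < M" "\<rho> \<le> r"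
      using that \<rho>s \<open>M > 0\<close> by (auto simp: r_def min_def)
    define \<delta> where "\<delta> = ((1 + (r / M)\<^sup>2 * (exp (M\<^sup>2) - 1)) ^ n - 1) / CARD('d)"
    have "\<delta> < (eta \<alpha> \<beta>)\<^sup>2"
      unfolding \<delta>_def using assms(1,2) r
      by (intro chi_square_less_eta) (auto simp: \<rho>\<^sub>s_def Suc_le_eq)
    \<comment> \<open>The free parameter of the second-moment bound is set to \<open>\<eta>\<close>.\<close>
    then have "(\<delta> + (eta \<alpha> \<beta>)\<^sup>2) / (4 * eta \<alpha> \<beta>) < eta \<alpha> \<beta> / 2"
      using \<eta> by (simp add: field_simps power2_eq_square)
    moreover have "eta \<alpha> \<beta> / 2 = 1 - \<alpha> - \<beta>"
      by (simp add: eta_def)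
    ultimately have "\<beta> < 1 - \<alpha> - (\<delta> + (eta \<alpha> \<beta>)\<^sup>2) / (4 * eta \<alpha> \<beta>)"
      by linarith
    then have "ereal \<beta> < ereal (1 - \<alpha> - (\<delta> + (eta \<alpha> \<beta>)\<^sup>2) / (4 * eta \<alpha> \<beta>))"
      by simp
    also have "\<dots> \<le> (INF \<Psi> \<in> level_tests n \<alpha>. max_type2_error n \<Psi> F \<rho>)"
      unfolding F_def \<delta>_def using r \<eta> by (intro INF_greatest max_type2_error_ge)
    finally show ?thesis .
  qed
  \<comment> \<open>Since \<open>\<epsilon> < 1\<close>, alternatives at distance \<open>\<rho>\<close> exist only for \<open>\<rho>\<close> strictly below \<open>M\<close>.\<close>
  have "\<rho> < M" if nonempty: "separated F \<rho> \<noteq> {}" for \<rho>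
  proof -
    obtain \<epsilon> and \<mu> :: "real ^ 'd" where "0 < \<epsilon>" "\<epsilon> < 1" "infnorm \<mu> \<le> M" "\<rho> \<le> \<epsilon> * infnorm \<mu>"
      using nonempty by (auto simp: F_def separated_def F_infty_def)
    moreover from this have "\<epsilon> * infnorm \<mu> \<le> \<epsilon> * M" "\<epsilon> * M < 1 * M"
      using \<open>M > 0\<close> by (auto intro: mult_left_mono mult_strict_right_mono)
    ultimately show ?thesis by linarith
  qed
  moreover have "minimax_separation n F \<alpha> \<beta> \<ge> ereal \<rho>\<^sub>s" if "\<rho>\<^sub>s \<le> M"
    unfolding minimax_separation_def uniform_separation_def
  proof (intro INF_greatest Inf_greatest)
    fix \<Psi> :: "(nat \<Rightarrow> real ^ 'd) \<Rightarrow> nat" and e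
    assume \<Psi>: "\<Psi> \<in> level_tests n \<alpha>"
      and "e \<in> {ereal \<rho> |\<rho>. 0 < \<rho> \<and> max_type2_error n \<Psi> F \<rho> \<le> ereal \<beta>}"
    then obtain \<rho> where e: "e = ereal \<rho>" and \<rho>: "max_type2_error n \<Psi> F \<rho> \<le> ereal \<beta>"
      by blast
    have "\<not> \<rho> < \<rho>\<^sub>s"
    proof
      assume "\<rho> < \<rho>\<^sub>s"
      with that have "ereal \<beta> < (INF \<Psi> \<in> level_tests n \<alpha>. max_type2_error n \<Psi> F \<rho>)"
        by (intro lower) auto
      also have "\<dots> \<le> max_type2_error n \<Psi> F \<rho>"
        using \<Psi> by (rule INF_lower)
      finally show False using \<rho> by simp
    qed
    then show "ereal \<rho>\<^sub>s \<le> e" by (simp add: e)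
  qed
  ultimately show ?thesis using lower by blast
qed

end
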